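(* The sequence of $\mathcal{O}\Sigma$-sets $\{\mathcal{O}\Sigma_n\}_{n\geq 0}$ forms an operad (non-unital, with permutations) in the symmetric monoidal category $(\mathrm{Set}^{\mathcal{O}\Sigma^{\mathrm{op}}},\times,\ast)$ of $\mathcal{O}\Sigma$-sets with the Cartesian product. The structure maps of the operad are the maps $$\Psi_{k_1,\ldots,k_n}: \mathcal{O}\Sigma_n\times \mathcal{O}\Sigma_{k_1}\times\cdots\times \mathcal{O}\Sigma_{k_n}\to\mathcal{O}\Sigma_{k_1+\cdots+k_n},\qquad \Psi_{k_1,\ldots,k_n}(f;g_1,\ldots,g_n) = f\langle g_1\circ i_{f^{-1}(1)},\ldots, g_n\circ i_{f^{-1}(n)}\rangle$$ for $(f;g_1,\ldots,g_n)\in\mathcal{O}\Sigma(\overline{k},\overline{n})\times\mathcal{O}\Sigma(\overline{k},\overline{k_1})\times\cdots\times\mathcal{O}\Sigma(\overline{k},\overline{k_n})$, $k\ge 0$. The right action of the symmetric group $\Sigma_n$ on $\mathcal{O}\Sigma_n$ is given by $f\circ\pi=\pi^{-1}f$ for $f\in\mathcal{O}\Sigma_n(k)$ and $\pi\in\Sigma_n$.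
   Context: For $n\ge 0$ let $\overline{n}=\{1,\ldots,n\}$, $\overline{0}=\emptyset$. The category $\mathcal{O}\Sigma$ has objects $\overline{n}$, $n\geq 0$; a morphism $f\in\mathcal{O}\Sigma(\overline{n},\overline{m})$ is a map of sets $f:\overline{n}\to\overline{m}$ together with a total order on each fibre $f^{-1}(i)$, $i\in\overline{m}$. Composition $gf$ composes the underlying maps and orders $(gf)^{-1}(i)$ as the ordered union, over $k\in g^{-1}(i)$ taken in the order given by $g$, of the ordered sets $f^{-1}(k)$. An injective map of sets determines a unique morphism of $\mathcal{O}\Sigma$; in particular $\Sigma_n\subseteq\mathcal{O}\Sigma(\overline{n},\overline{n})$, and $\pi^{-1}f$ denotes composition in $\mathcal{O}\Sigma$. An $\mathcal{O}\Sigma$-set is a contravariant functor $X$ from $\mathcal{O}\Sigma$ to sets; $X(n)$ denotes $X(\overline{n})$. The $\mathcal{O}\Sigma$-set $\mathcal{O}\Sigma_n$ is the representable one, $\mathcal{O}\Sigma_n(k)=\mathcal{O}\Sigma(\overline{k},\overline{n})$. The product $\times$ is taken degreewise and $\ast$ is the constant one-point $\mathcal{O}\Sigma$-set. For $I\subseteq\overline{m}$, $i_I:\overline{|I|}\to\overline{m}$ is the morphism given by the order-preserving injection with image $I$. For a map $f:\overline{k}\to\overline{n}$ (a set map, or a morphism of $\mathcal{O}\Sigma$, in which case only its underlying set map is used) and morphisms $h_i\in\mathcal{O}\Sigma(\overline{|f^{-1}(i)|},\overline{k_i})$, $1\le i\le n$, the morphism $f\langle h_1,\ldots,h_n\rangle\in\mathcal{O}\Sigma(\overline{k},\overline{k_1+\cdots+k_n})$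 is the unique morphism $h$ such that for each $i$ one has $h\circ i_{f^{-1}(i)}=\iota_i\circ h_i$, where $\iota_i:\overline{k_i}\to\overline{k_1+\cdots+k_n}$ is the order-preserving inclusion of the $i$-th block. "Non-unital, with permutations" means that the operad has symmetric group actions and satisfies the associativity and equivariance axioms, but no operadic unit is required. *)

theory Defs
  imports "HOL-Library.FuncSet" "HOL-Combinatorics.Permutations"
begin

section \<open>The category of finite ordinals and maps with totally ordered fibres\<close>

text \<open>
  The object $\overline{n}$ is the set \<open>{1..n}\<close>. A morphism records its source, its target, the
  underlying map and, for each \<open>i\<close>, the (reflexive) total order on the fibre over \<open>i\<close>. The map is
  \<open>undefined\<close> outside the source and the order is empty for \<open>i\<close> outside the target,
  so that equality of records is equality of morphisms.
\<close>

record omor =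
  odom :: nat
  ocod :: nat
  omap :: "nat \<Rightarrow> nat"
  oord :: "nat \<Rightarrow> nat rel"

definition fib :: "nat \<Rightarrow> (nat \<Rightarrow> nat) \<Rightarrow> nat \<Rightarrow> nat set" where
  "fib k f i = {x \<in> {1..k}. f x = i}"

definition OSigma :: "nat \<Rightarrow> nat \<Rightarrow> omor set" where
  "OSigma n m = {f. odom f = n \<and> ocod f = m \<and> omap f \<in> {1..n} \<rightarrow>\<^sub>E {1..m} \<and>
     (\<forall>i\<in>{1..m}. linear_order_on (fib n (omap f) i) (oord f i)) \<and>
     (\<forall>i. i \<notin> {1..m} \<longrightarrow> oord f i = {})}"

definition ocomp :: "omor \<Rightarrow> omor \<Rightarrow> omor"  (infixl "\<circ>\<^sub>O" 70) where
  "g \<circ>\<^sub>O f = \<lparr>odom = odom f, ocod = ocod g,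
     omap = restrict (\<lambda>x. omap g (omap f x)) {1..odom f},
     oord = (\<lambda>i. {(x, y). x \<in> fib (odom f) (\<lambda>z. omap g (omap f z)) i \<and>
                          y \<in> fib (odom f) (\<lambda>z. omap g (omap f z)) i \<and>
                          (if omap f x = omap f y then (x, y) \<in> oord f (omap f x)
                           else (omap f x, omap f y) \<in> oord g i)})\<rparr>"

text \<open>
  The morphism determined by a map \<open>f\<close> that is injective on \<open>{1..n}\<close>: its fibres have at most one
  element.
\<close>

definition oinj :: "nat \<Rightarrow> nat \<Rightarrow> (nat \<Rightarrow> nat) \<Rightarrow> omor" where
  "oinj n m f = \<lparr>odom = n, ocod = m, omap = restrict f {1..n},
     oord = (\<lambda>i. if i \<in> {1..m} then Id_on (fib n f i) else {})\<rparr>"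

definition oid :: "nat \<Rightarrow> omor" where
  "oid n = oinj n n id"

definition incl :: "nat \<Rightarrow> nat set \<Rightarrow> omor" where
  "incl m I = oinj (card I) m (\<lambda>j. sorted_list_of_set I ! (j - 1))"


section \<open>Blocks\<close>

text \<open>
  A list \<open>ks = [k\<^sub>1, \<dots>, k\<^sub>n]\<close> splits \<open>{1..k\<^sub>1 + \<dots> + k\<^sub>n}\<close> into consecutive blocks, numbered from \<open>1\<close>.
  \<open>bpos ks i j\<close> is the \<open>j\<close>-th element of the \<open>i\<close>-th block; conversely \<open>p\<close> is the
  \<open>boff ks p\<close>-th element of the block with number \<open>bnum ks p\<close>.
\<close>

definition bpos :: "nat list \<Rightarrow> nat \<Rightarrow> nat \<Rightarrow> nat" where
  "bpos ks i j = sum_list (take (i - 1) ks) + j"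

definition bnum :: "nat list \<Rightarrow> nat \<Rightarrow> nat" where
  "bnum ks p = (LEAST i. p \<le> sum_list (take i ks))"

definition boff :: "nat list \<Rightarrow> nat \<Rightarrow> nat" where
  "boff ks p = p - sum_list (take (bnum ks p - 1) ks)"

definition block_incl :: "nat list \<Rightarrow> nat \<Rightarrow> omor" where
  "block_incl ks i = oinj (ks ! (i - 1)) (sum_list ks) (bpos ks i)"

text \<open>
  \<open>bracket k f [h\<^sub>1, \<dots>, h\<^sub>n]\<close> is $f\langle h_1,\ldots,h_n\rangle$ for a map \<open>f : {1..k} \<rightarrow> {1..n}\<close>; the
  numbers $k_i$ are the targets of the $h_i$.
\<close>

definition bracket :: "nat \<Rightarrow> (nat \<Rightarrow> nat) \<Rightarrow> omor list \<Rightarrow> omor" where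
  "bracket k f hs = (THE h. h \<in> OSigma k (sum_list (map ocod hs)) \<and>
     (\<forall>i\<in>{1..length hs}.
        h \<circ>\<^sub>O incl k (fib k f i) = block_incl (map ocod hs) i \<circ>\<^sub>O (hs ! (i - 1))))"


section \<open>Presheaves on this category and their products\<close>

record 'a oset =
  elt :: "nat \<Rightarrow> 'a set"
  act :: "omor \<Rightarrow> 'a \<Rightarrow> 'a"

definition is_oset :: "'a oset \<Rightarrow> bool" where
  "is_oset X \<longleftrightarrow>
     (\<forall>n m. \<forall>f\<in>OSigma n m. \<forall>x\<in>elt X m. act X f x \<in> elt X n) \<and>
     (\<forall>n. \<forall>x\<in>elt X n. act X (oid n) x = x) \<and>
     (\<forall>l n m. \<forall>f\<in>OSigma l n. \<forall>g\<in>OSigma n m. \<forall>x\<in>elt X m.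
        act X (g \<circ>\<^sub>O f) x = act X f (act X g x))"

definition is_omap :: "'a oset \<Rightarrow> 'b oset \<Rightarrow> (nat \<Rightarrow> 'a \<Rightarrow> 'b) \<Rightarrow> bool" where
  "is_omap X Y F \<longleftrightarrow>
     (\<forall>n. \<forall>x\<in>elt X n. F n x \<in> elt Y n) \<and>
     (\<forall>n m. \<forall>f\<in>OSigma n m. \<forall>x\<in>elt X m. F n (act X f x) = act Y f (F m x))"

definition oprod2 :: "'a oset \<Rightarrow> 'b oset \<Rightarrow> ('a \<times> 'b) oset"  (infixr "\<times>\<^sub>O" 80) where
  "X \<times>\<^sub>O Y = \<lparr>elt = (\<lambda>n. elt X n \<times> elt Y n), act = (\<lambda>f. map_prod (act X f) (act Y f))\<rparr>"

text \<open>
  The product of a finite list of presheaves. The empty product is the constant presheaf with the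
  single element \<open>[]\<close>, i.e. the monoidal unit.
\<close>

definition oprod :: "'a oset list \<Rightarrow> 'a list oset" where
  "oprod Xs = \<lparr>elt = (\<lambda>n. {xs. list_all2 (\<lambda>x X. x \<in> elt X n) xs Xs}),
               act = (\<lambda>f xs. map2 (\<lambda>X x. act X f x) Xs xs)\<rparr>"

definition orep :: "nat \<Rightarrow> omor oset" where
  "orep n = \<lparr>elt = (\<lambda>k. OSigma k n), act = (\<lambda>h f. f \<circ>\<^sub>O h)\<rparr>"


section \<open>Non-unital operads with permutations\<close>

text \<open>
  The entry with number \<open>\<pi> i\<close> of \<open>perm_list \<pi> xs\<close> is the \<open>i\<close>-th entry of \<open>xs\<close>, i.e.
  the list is $(x_{\pi^{-1}(1)}, \ldots, x_{\pi^{-1}(n)})$.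
\<close>

definition perm_list :: "(nat \<Rightarrow> nat) \<Rightarrow> 'a list \<Rightarrow> 'a list" where
  "perm_list \<pi> xs = map (\<lambda>i. xs ! (inv \<pi> i - 1)) [1..<Suc (length xs)]"

text \<open>
  May's $\pi(k_1,\ldots,k_n)$: the \<open>i\<close>-th block of the partition \<open>ks\<close> is moved, preserving the order
  inside it, onto the block with number \<open>\<pi> i\<close> of the permuted partition.
\<close>

definition block_perm :: "(nat \<Rightarrow> nat) \<Rightarrow> nat list \<Rightarrow> nat \<Rightarrow> nat" where
  "block_perm \<pi> ks p =
     (if p \<in> {1..sum_list ks} then bpos (perm_list \<pi> ks) (\<pi> (bnum ks p)) (boff ks p) else p)"

text \<open>The block sum $\tau_1 \oplus \cdots \oplus \tau_n$.\<close>

definition block_sum :: "nat list \<Rightarrow> (nat \<Rightarrow> nat) list \<Rightarrow> nat \<Rightarrow> nat" where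
  "block_sum ks \<tau>s p =
     (if p \<in> {1..sum_list ks} then bpos ks (bnum ks p) ((\<tau>s ! (bnum ks p - 1)) (boff ks p)) else p)"

text \<open>
  \<open>P n\<close> is the \<open>n\<close>-th object, \<open>R n \<pi>\<close> the right action of \<open>\<pi>\<close> on it (a morphism given by its
  components at all degrees) and \<open>\<gamma> [k\<^sub>1, \<dots>, k\<^sub>n]\<close> the structure map
  $P(n) \times (P(k_1) \times\cdots\times P(k_n)) \to P(k_1+\cdots+k_n)$. Since products of presheaves
  are taken degreewise, the equalities of morphisms in the axioms are stated on the elements of each degree \<open>k\<close>.
  In the associativity axiom \<open>lss ! (i - 1)\<close> is the list $[l_{i1},\ldots,l_{ik_i}]$, so that
  $k_i$ is its length.
\<close>

definition right_action ::
  "(nat \<Rightarrow> 'a oset) \<Rightarrow> (nat \<Rightarrow> (nat \<Rightarrow> nat) \<Rightarrow> nat \<Rightarrow> 'a \<Rightarrow> 'a) \<Rightarrow> bool" where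
  "right_action P R \<longleftrightarrow>
     (\<forall>n \<pi>. \<pi> permutes {1..n} \<longrightarrow> is_omap (P n) (P n) (R n \<pi>)) \<and>
     (\<forall>n k. \<forall>f\<in>elt (P n) k. R n id k f = f) \<and>
     (\<forall>n \<pi> \<rho> k. \<forall>f\<in>elt (P n) k. \<pi> permutes {1..n} \<longrightarrow> \<rho> permutes {1..n} \<longrightarrow>
        R n (\<pi> \<circ> \<rho>) k f = R n \<rho> k (R n \<pi> k f))"

definition operad_assoc ::
  "(nat \<Rightarrow> 'a oset) \<Rightarrow> (nat list \<Rightarrow> nat \<Rightarrow> 'a \<times> 'a list \<Rightarrow> 'a) \<Rightarrow> bool" where
  "operad_assoc P \<gamma> \<longleftrightarrow>
     (\<forall>lss k f gs hss.
        f \<in> elt (P (length lss)) k \<longrightarrow>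
        gs \<in> elt (oprod (map P (map length lss))) k \<longrightarrow>
        hss \<in> elt (oprod (map (\<lambda>ls. oprod (map P ls)) lss)) k \<longrightarrow>
        \<gamma> (concat lss) k (\<gamma> (map length lss) k (f, gs), concat hss) =
        \<gamma> (map sum_list lss) k
          (f, map2 (\<lambda>ls (g, hs). \<gamma> ls k (g, hs)) lss (zip gs hss)))"

definition operad_equivariant ::
  "(nat \<Rightarrow> 'a oset) \<Rightarrow> (nat list \<Rightarrow> nat \<Rightarrow> 'a \<times> 'a list \<Rightarrow> 'a) \<Rightarrow>
   (nat \<Rightarrow> (nat \<Rightarrow> nat) \<Rightarrow> nat \<Rightarrow> 'a \<Rightarrow> 'a) \<Rightarrow> bool" where
  "operad_equivariant P \<gamma> R \<longleftrightarrow>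
     (\<forall>ks \<pi> k f gs.
        \<pi> permutes {1..length ks} \<longrightarrow>
        f \<in> elt (P (length ks)) k \<longrightarrow>
        gs \<in> elt (oprod (map P ks)) k \<longrightarrow>
        \<gamma> ks k (R (length ks) \<pi> k f, gs) =
        R (sum_list ks) (block_perm \<pi> ks) k
          (\<gamma> (perm_list \<pi> ks) k (f, perm_list \<pi> gs))) \<and>
     (\<forall>ks \<tau>s k f gs.
        list_all2 (\<lambda>\<tau> m. \<tau> permutes {1..m}) \<tau>s ks \<longrightarrow>
        f \<in> elt (P (length ks)) k \<longrightarrow>
        gs \<in> elt (oprod (map P ks)) k \<longrightarrow>
        \<gamma> ks k (f, map2 (\<lambda>m (\<tau>, g). R m \<tau> k g) ks (zip \<tau>s gs)) =
        R (sum_list ks) (block_sum ks \<tau>s) k (\<gamma> ks k (f, gs)))"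

definition nonunital_operad ::
  "(nat \<Rightarrow> 'a oset) \<Rightarrow> (nat list \<Rightarrow> nat \<Rightarrow> 'a \<times> 'a list \<Rightarrow> 'a) \<Rightarrow>
   (nat \<Rightarrow> (nat \<Rightarrow> nat) \<Rightarrow> nat \<Rightarrow> 'a \<Rightarrow> 'a) \<Rightarrow> bool" where
  "nonunital_operad P \<gamma> R \<longleftrightarrow>
     (\<forall>n. is_oset (P n)) \<and>
     right_action P R \<and>
     (\<forall>ks. is_omap (P (length ks) \<times>\<^sub>O oprod (map P ks)) (P (sum_list ks)) (\<gamma> ks)) \<and>
     operad_assoc P \<gamma> \<and>
     operad_equivariant P \<gamma> R"


section \<open>The structure on the representable presheaves\<close>

definition Psi :: "nat list \<Rightarrow> nat \<Rightarrow> omor \<times> omor list \<Rightarrow> omor" where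
  "Psi ks k = (\<lambda>(f, gs).
     bracket k (omap f)
       (map (\<lambda>i. (gs ! (i - 1)) \<circ>\<^sub>O incl k (fib k (omap f) i)) [1..<Suc (length ks)]))"

definition sym_act :: "nat \<Rightarrow> (nat \<Rightarrow> nat) \<Rightarrow> nat \<Rightarrow> omor \<Rightarrow> omor" where
  "sym_act n \<pi> k f = oinj n n (inv \<pi>) \<circ>\<^sub>O f"

end

theory Submission
  imports Defs
begin

text \<open>
  A morphism of the category is the same thing as a map \<open>\<phi>\<close> together with one partial order on the whole
  source, \<open>fibre_le\<close>, in which two elements are comparable exactly when \<open>\<phi>\<close> identifies them. In this
  language composition is lexicographic: below \<open>g \<circ>\<^sub>O f\<close>, two points are compared by \<open>f\<close> if \<open>f\<close>
  identifies them, and otherwise their images are compared by \<open>g\<close>. Precomposing with the inclusion of a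
  subset restricts both the map and the order, and postcomposing with an injection leaves the order
  unchanged.

  Let \<open>g\<^sub>1, \<dots>, g\<^sub>n\<close> be the remaining arguments of \<open>Psi\<close>. The morphism \<open>Psi ks k (f, gs)\<close> sends \<open>x\<close> to
  the \<open>j\<close>-th element of the \<open>i\<close>-th block, where \<open>i = f x\<close> and \<open>j = g\<^sub>i x\<close>, and compares two points with
  the same \<open>i\<close> by \<open>g\<^sub>i\<close>. This morphism is called \<open>glue\<close> below; \<open>Psi_eq_glue\<close> identifies it with the
  definite description in \<open>bracket\<close>. It satisfies the defining equations because restricting it to the
  fibre over \<open>i\<close> gives the restriction of \<open>g\<^sub>i\<close> followed by a block inclusion. It is the only solution:
  the fibres of \<open>f\<close> cover the source, and points in different fibres of \<open>f\<close> land in different blocks, so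
  no comparison between them is left undetermined.

  Every operad axiom is now a comparison of maps and of orders, where points with equal image under
  \<open>Psi\<close> are compared by the last argument through which they are sent. For associativity both sides send \<open>x\<close> to \<open>(i, j, l)\<close> with \<open>i = f x\<close>, \<open>j = g\<^sub>i x\<close>, \<open>l = h\<^sub>i\<^sub>j x\<close>
  and use the order of \<open>h\<^sub>i\<^sub>j\<close>; they differ only in the way such triples are numbered, and
  \<open>bpos_concat\<close> says that the two numberings agree. In the equivariance axioms
  the group elements act on the labels \<open>(i, j)\<close> alone, and \<open>inv_block_perm_bpos\<close> and
  \<open>inv_block_sum_bpos\<close> compute the inverses of the two block permutations on those labels.
\<close>

section \<open>Morphisms as maps with a partial order on the source\<close>

text \<open>
  The fibrewise orders of a morphism, united into a single relation. It decides the order within a fibre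
  without naming the point below it, which makes the composition rule \<open>fibre_le_ocomp\<close> possible.
\<close>

definition fibre_le :: "omor \<Rightarrow> nat \<Rightarrow> nat \<Rightarrow> bool" where
  "fibre_le f x y \<longleftrightarrow> omap f x = omap f y \<and> (x, y) \<in> oord f (omap f x)"

lemma OSigma_odom: "f \<in> OSigma n m \<Longrightarrow> odom f = n"
  and OSigma_ocod: "f \<in> OSigma n m \<Longrightarrow> ocod f = m"
  by (auto simp: OSigma_def)

lemma OSigma_range: "f \<in> OSigma n m \<Longrightarrow> x \<in> {1..n} \<Longrightarrow> omap f x \<in> {1..m}"
  by (auto simp: OSigma_def PiE_iff)

lemma OSigma_linear_order:
  assumes "f \<in> OSigma n m" "x \<in> {1..n}"
  shows "linear_order_on (fib n (omap f) (omap f x)) (oord f (omap f x))"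
  using assms(1) OSigma_range[OF assms] by (simp add: OSigma_def)

lemma fibre_le_refl: "f \<in> OSigma n m \<Longrightarrow> x \<in> {1..n} \<Longrightarrow> fibre_le f x x"
  using OSigma_linear_order[of f n m x]
  by (auto simp: fibre_le_def order_on_defs refl_on_def fib_def)

lemma fibre_le_antisym:
  "f \<in> OSigma n m \<Longrightarrow> x \<in> {1..n} \<Longrightarrow> fibre_le f x y \<Longrightarrow> fibre_le f y x \<Longrightarrow> x = y"
  using OSigma_linear_order[of f n m x]
  by (auto simp: fibre_le_def order_on_defs dest: antisymD)

lemma fibre_le_trans:
  "f \<in> OSigma n m \<Longrightarrow> x \<in> {1..n} \<Longrightarrow> fibre_le f x y \<Longrightarrow> fibre_le f y z \<Longrightarrow> fibre_le f x z"
  using OSigma_linear_order[of f n m x]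
  by (auto simp: fibre_le_def order_on_defs dest: transD)

lemma fibre_le_total:
  assumes "f \<in> OSigma n m" "x \<in> {1..n}" "y \<in> {1..n}" "omap f x = omap f y"
  shows "fibre_le f x y \<or> fibre_le f y x"
proof (cases "x = y")
  case True
  then show ?thesis using fibre_le_refl[OF assms(1,2)] by simp
next
  case False
  have "x \<in> fib n (omap f) (omap f x)" "y \<in> fib n (omap f) (omap f x)"
    using assms by (auto simp: fib_def)
  then show ?thesis
    using OSigma_linear_order[OF assms(1,2)] False assms(4)
    unfolding fibre_le_def order_on_defs total_on_def by metis
qed

lemma fibre_le_same_fibre: "fibre_le f x y \<Longrightarrow> omap f x = omap f y"
  by (simp add: fibre_le_def)

text \<open>
  No information is lost in passing to \<open>fibre_le\<close>: each order lives on its fibre, and over points outside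
  the target both sides are empty.
\<close>

lemma oord_eq_fibre_le:
  assumes "f \<in> OSigma n m"
  shows "oord f i = {(x, y). x \<in> {1..n} \<and> y \<in> {1..n} \<and> omap f x = i \<and> fibre_le f x y}"
proof (cases "i \<in> {1..m}")
  case True
  then have "oord f i \<subseteq> fib n (omap f) i \<times> fib n (omap f) i"
    using assms by (auto simp: OSigma_def order_on_defs)
  then show ?thesis by (auto simp: fib_def fibre_le_def)
next
  case False
  then have "oord f i = {}" using assms by (simp add: OSigma_def)
  then show ?thesis using False OSigma_range[OF assms] by auto
qed

text \<open>
  The extensionality principle through which all equations between morphisms are proved. It restricts the
  comparison to the source, so that the values forced outside it never have to be discussed again.
\<close>

lemma OSigma_eqI:
  assumes "f \<in> OSigma n m" "g \<in> OSigma n m"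
    and "\<And>x. x \<in> {1..n} \<Longrightarrow> omap f x = omap g x"
    and "\<And>x y. x \<in> {1..n} \<Longrightarrow> y \<in> {1..n} \<Longrightarrow> fibre_le f x y \<longleftrightarrow> fibre_le g x y"
  shows "f = g"
proof -
  have "omap f \<in> {1..n} \<rightarrow>\<^sub>E {1..m}" "omap g \<in> {1..n} \<rightarrow>\<^sub>E {1..m}"
    using assms(1,2) by (auto simp: OSigma_def)
  then have "omap f = omap g" using assms(3) by (rule PiE_ext)
  moreover have "oord f i = oord g i" for i
    unfolding oord_eq_fibre_le[OF assms(1)] oord_eq_fibre_le[OF assms(2)]
    by (auto simp: assms(3,4) simp del: atLeastAtMost_iff One_nat_def)
  then have "oord f = oord g" by blast
  moreover have "odom f = odom g" "ocod f = ocod g"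
    using assms(1,2) by (auto simp: OSigma_def)
  ultimately show ?thesis by simp
qed

text \<open>
  Pairs in \<open>L\<close> that lie in different fibres of \<open>\<phi>\<close> are discarded, so that \<open>L\<close> can be written down by a
  formula that makes sense only inside the fibres; the hypotheses of \<open>mk_omor_in_OSigma\<close> are relative to
  fibres for the same reason.
\<close>

definition mk_omor :: "nat \<Rightarrow> nat \<Rightarrow> (nat \<Rightarrow> nat) \<Rightarrow> (nat \<Rightarrow> nat \<Rightarrow> bool) \<Rightarrow> omor" where
  "mk_omor n m \<phi> L = \<lparr>odom = n, ocod = m, omap = restrict \<phi> {1..n},
     oord = (\<lambda>i. {(x, y). x \<in> {1..n} \<and> y \<in> {1..n} \<and> \<phi> x = i \<and> \<phi> y = i \<and> L x y})\<rparr>"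

lemma omap_mk_omor: "x \<in> {1..n} \<Longrightarrow> omap (mk_omor n m \<phi> L) x = \<phi> x"
  by (simp add: mk_omor_def)

lemma fibre_le_mk_omor:
  "x \<in> {1..n} \<Longrightarrow> y \<in> {1..n} \<Longrightarrow> fibre_le (mk_omor n m \<phi> L) x y \<longleftrightarrow> \<phi> x = \<phi> y \<and> L x y"
  by (auto simp: fibre_le_def mk_omor_def)

lemma mk_omor_in_OSigma:
  assumes range: "\<And>x. x \<in> {1..n} \<Longrightarrow> \<phi> x \<in> {1..m}"
    and refl: "\<And>x. x \<in> {1..n} \<Longrightarrow> L x x"
    and antisym: "\<And>x y. x \<in> {1..n} \<Longrightarrow> y \<in> {1..n} \<Longrightarrow> \<phi> x = \<phi> y \<Longrightarrow> L x y \<Longrightarrow> L y x \<Longrightarrow> x = y"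
    and trans: "\<And>x y z. x \<in> {1..n} \<Longrightarrow> y \<in> {1..n} \<Longrightarrow> z \<in> {1..n} \<Longrightarrow> \<phi> x = \<phi> y \<Longrightarrow> \<phi> y = \<phi> z
      \<Longrightarrow> L x y \<Longrightarrow> L y z \<Longrightarrow> L x z"
    and total: "\<And>x y. x \<in> {1..n} \<Longrightarrow> y \<in> {1..n} \<Longrightarrow> \<phi> x = \<phi> y \<Longrightarrow> L x y \<or> L y x"
  shows "mk_omor n m \<phi> L \<in> OSigma n m"
proof -
  let ?R = "\<lambda>i. {(x, y). x \<in> {1..n} \<and> y \<in> {1..n} \<and> \<phi> x = i \<and> \<phi> y = i \<and> L x y}"
  have fib: "fib n (restrict \<phi> {1..n}) i = {x \<in> {1..n}. \<phi> x = i}" for i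
    by (auto simp: fib_def)
  have "linear_order_on (fib n (restrict \<phi> {1..n}) i) (?R i)" for i
    unfolding order_on_defs fib
  proof (intro conjI)
    show "refl_on {x \<in> {1..n}. \<phi> x = i} (?R i)" using refl by (auto simp: refl_on_def)
    show "Relation.trans (?R i)"
    proof (rule transI)
      show "(x, z) \<in> ?R i" if "(x, y) \<in> ?R i" "(y, z) \<in> ?R i" for x y z
        using trans[of x y z] that by simp
    qed
    show "Relation.antisym (?R i)"
    proof (rule antisymI)
      show "x = y" if "(x, y) \<in> ?R i" "(y, x) \<in> ?R i" for x y
        using antisym[of x y] that by simp
    qed
    show "total_on {x \<in> {1..n}. \<phi> x = i} (?R i)"
    proof (rule total_onI)
      show "(x, y) \<in> ?R i \<or> (y, x) \<in> ?R i"
        if "x \<in> {x \<in> {1..n}. \<phi> x = i}" "y \<in> {x \<in> {1..n}. \<phi> x = i}" for x y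
        using total[of x y] that by simp
    qed
  qed auto
  moreover have "?R i = {}" if "i \<notin> {1..m}" for i using that range by blast
  moreover have "restrict \<phi> {1..n} \<in> {1..n} \<rightarrow>\<^sub>E {1..m}" using range by simp
  ultimately show ?thesis unfolding OSigma_def mk_omor_def by simp
qed

section \<open>Composition, injections and inclusions\<close>

lemma omap_ocomp: "f \<in> OSigma n m \<Longrightarrow> x \<in> {1..n} \<Longrightarrow> omap (g \<circ>\<^sub>O f) x = omap g (omap f x)"
  by (simp add: ocomp_def OSigma_odom)

text \<open>
  The ordered union in the definition of composition, as a lexicographic comparison. In the second
  alternative \<open>fibre_le g\<close> already contains the condition that \<open>g\<close> identifies the two images.
\<close>

lemma fibre_le_ocomp:
  assumes "f \<in> OSigma n m" "x \<in> {1..n}" "y \<in> {1..n}"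
  shows "fibre_le (g \<circ>\<^sub>O f) x y \<longleftrightarrow>
    (if omap f x = omap f y then fibre_le f x y else fibre_le g (omap f x) (omap f y))"
  using assms by (auto simp: ocomp_def OSigma_odom fibre_le_def fib_def)

lemma ocomp_in_OSigma:
  assumes f: "f \<in> OSigma n m" and g: "g \<in> OSigma m l"
  shows "g \<circ>\<^sub>O f \<in> OSigma n l"
proof -
  let ?L = "\<lambda>x y. if omap f x = omap f y then fibre_le f x y else fibre_le g (omap f x) (omap f y)"
  have "mk_omor n l (\<lambda>x. omap g (omap f x)) ?L \<in> OSigma n l"
  proof (rule mk_omor_in_OSigma)
    fix x assume x: "x \<in> {1..n}"
    note fx = OSigma_range[OF f x]
    show "omap g (omap f x) \<in> {1..l}" using OSigma_range[OF g fx] .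
    show "?L x x" using fibre_le_refl[OF f x] by simp
    fix y assume y: "y \<in> {1..n}" and xy: "omap g (omap f x) = omap g (omap f y)"
    note fy = OSigma_range[OF f y]
    show "?L x y \<or> ?L y x"
      using fibre_le_total[OF f x y] fibre_le_total[OF g fx fy xy] by auto
    show "x = y" if "?L x y" "?L y x"
      using that fibre_le_antisym[OF f x, of y] fibre_le_antisym[OF g fx, of "omap f y"]
      by (auto split: if_splits)
    fix z assume z: "z \<in> {1..n}"
    show "?L x z" if "?L x y" "?L y z"
    proof -
      consider "omap f x = omap f y" | "omap f y = omap f z" | "omap f x = omap f z"
          "omap f x \<noteq> omap f y" | "omap f x \<noteq> omap f y" "omap f y \<noteq> omap f z" "omap f x \<noteq> omap f z"
        by blast
      then show ?thesis
      proof cases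
        case 1
        then show ?thesis using that fibre_le_trans[OF f x, of y z] by (auto split: if_splits)
      next
        case 2
        then show ?thesis using that fibre_le_trans[OF f x, of y z] by (auto split: if_splits)
      next
        \<comment> \<open>If \<open>x\<close> and \<open>z\<close> have the same image but \<open>y\<close> has another one, antisymmetry of \<open>g\<close> is violated.\<close>
        case 3
        then have "fibre_le g (omap f x) (omap f y)" "fibre_le g (omap f y) (omap f x)"
          using that by simp_all
        with 3(2) show ?thesis using fibre_le_antisym[OF g fx, of "omap f y"] by blast
      next
        case 4
        then show ?thesis using that fibre_le_trans[OF g fx, of "omap f y" "omap f z"] by simp
      qed
    qed
  qed
  also have "mk_omor n l (\<lambda>x. omap g (omap f x)) ?L = g \<circ>\<^sub>O f"
  proof -
    have "oord (mk_omor n l (\<lambda>x. omap g (omap f x)) ?L) i = oord (g \<circ>\<^sub>O f) i" for i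
    proof -
      have "(x, y) \<in> oord (mk_omor n l (\<lambda>x. omap g (omap f x)) ?L) i \<longleftrightarrow> (x, y) \<in> oord (g \<circ>\<^sub>O f) i"
        for x y
        by (cases "omap f x = omap f y")
          (auto simp: mk_omor_def ocomp_def OSigma_odom[OF f] fib_def fibre_le_def)
      then show ?thesis by (intro equalityI subrelI) (simp_all only:)
    qed
    then have "oord (mk_omor n l (\<lambda>x. omap g (omap f x)) ?L) = oord (g \<circ>\<^sub>O f)" by (rule ext)
    then show ?thesis
      by (simp add: mk_omor_def ocomp_def OSigma_odom[OF f] OSigma_ocod[OF g])
  qed
  finally show ?thesis .
qed

lemma ocomp_assoc:
  assumes f: "f \<in> OSigma a b" and g: "g \<in> OSigma b c" and h: "h \<in> OSigma c d"
  shows "h \<circ>\<^sub>O (g \<circ>\<^sub>O f) = (h \<circ>\<^sub>O g) \<circ>\<^sub>O f"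
proof (rule OSigma_eqI)
  show "h \<circ>\<^sub>O (g \<circ>\<^sub>O f) \<in> OSigma a d" "(h \<circ>\<^sub>O g) \<circ>\<^sub>O f \<in> OSigma a d"
    by (rule ocomp_in_OSigma[OF ocomp_in_OSigma[OF f g] h],
        rule ocomp_in_OSigma[OF f ocomp_in_OSigma[OF g h]])
  note gf = ocomp_in_OSigma[OF f g]
  fix x assume x: "x \<in> {1..a}"
  note fx = OSigma_range[OF f x]
  show "omap (h \<circ>\<^sub>O (g \<circ>\<^sub>O f)) x = omap ((h \<circ>\<^sub>O g) \<circ>\<^sub>O f) x"
    unfolding omap_ocomp[OF gf x] omap_ocomp[OF f x] omap_ocomp[OF g fx] ..
  fix y assume y: "y \<in> {1..a}"
  note fy = OSigma_range[OF f y]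
  show "fibre_le (h \<circ>\<^sub>O (g \<circ>\<^sub>O f)) x y \<longleftrightarrow> fibre_le ((h \<circ>\<^sub>O g) \<circ>\<^sub>O f) x y"
    unfolding fibre_le_ocomp[OF gf x y] fibre_le_ocomp[OF f x y] fibre_le_ocomp[OF g fx fy]
      omap_ocomp[OF f x] omap_ocomp[OF f y] by simp
qed

lemma omap_oinj: "x \<in> {1..n} \<Longrightarrow> omap (oinj n m \<sigma>) x = \<sigma> x"
  by (simp add: oinj_def)

lemma oinj_eq_mk_omor:
  assumes "\<sigma> \<in> {1..n} \<rightarrow> {1..m}"
  shows "oinj n m \<sigma> = mk_omor n m \<sigma> (=)"
proof -
  have "(if i \<in> {1..m} then Id_on (fib n \<sigma> i) else {}) =
      {(x, y). x \<in> {1..n} \<and> y \<in> {1..n} \<and> \<sigma> x = i \<and> \<sigma> y = i \<and> x = y}" for i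
  proof -
    have "i \<in> {1..m}" if "x \<in> {1..n}" "\<sigma> x = i" for x
      using funcset_mem[OF assms that(1)] that(2) by simp
    then show ?thesis by (cases "i \<in> {1..m}") (auto simp: fib_def simp del: atLeastAtMost_iff One_nat_def)
  qed
  then show ?thesis by (simp only: oinj_def mk_omor_def)
qed

lemma oinj_in_OSigma:
  assumes "inj_on \<sigma> {1..n}" "\<sigma> \<in> {1..n} \<rightarrow> {1..m}"
  shows "oinj n m \<sigma> \<in> OSigma n m"
  unfolding oinj_eq_mk_omor[OF assms(2)]
proof (rule mk_omor_in_OSigma)
  show "\<sigma> x \<in> {1..m}" if "x \<in> {1..n}" for x by (rule funcset_mem[OF assms(2) that])
  show "x = y \<or> y = x" if "x \<in> {1..n}" "y \<in> {1..n}" "\<sigma> x = \<sigma> y" for x y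
    using inj_onD[OF assms(1) that(3,1,2)] by blast
qed (rule refl, assumption, erule (1) trans)

lemma fibre_le_oinj:
  assumes "\<sigma> \<in> {1..n} \<rightarrow> {1..m}" and "x \<in> {1..n}" "y \<in> {1..n}"
  shows "fibre_le (oinj n m \<sigma>) x y \<longleftrightarrow> x = y"
  unfolding oinj_eq_mk_omor[OF assms(1)] fibre_le_mk_omor[OF assms(2,3)] by blast

text \<open>
  Relabelling the target by an injection merges no fibres, so the order stays that of \<open>f\<close>. This covers
  the action of permutations as well as the block inclusions.
\<close>

lemma fibre_le_oinj_ocomp:
  assumes \<sigma>: "\<sigma> \<in> {1..n} \<rightarrow> {1..m}" and f: "f \<in> OSigma k n"
    and x: "x \<in> {1..k}" "y \<in> {1..k}"
  shows "fibre_le (oinj n m \<sigma> \<circ>\<^sub>O f) x y \<longleftrightarrow> fibre_le f x y"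
  unfolding fibre_le_ocomp[OF f x] fibre_le_oinj[OF \<sigma> OSigma_range[OF f x(1)] OSigma_range[OF f x(2)]]
  using fibre_le_same_fibre[of f x y] by argo

lemma oid_in_OSigma: "oid n \<in> OSigma n n"
  unfolding oid_def by (rule oinj_in_OSigma) auto

lemma ocomp_oid:
  assumes f: "f \<in> OSigma n m" shows "f \<circ>\<^sub>O oid n = f"
proof (rule OSigma_eqI)
  show "f \<circ>\<^sub>O oid n \<in> OSigma n m" by (rule ocomp_in_OSigma[OF oid_in_OSigma f])
  show "omap (f \<circ>\<^sub>O oid n) x = omap f x" if "x \<in> {1..n}" for x
    unfolding omap_ocomp[OF oid_in_OSigma that] using that by (simp add: oid_def omap_oinj)
  show "fibre_le (f \<circ>\<^sub>O oid n) x y = fibre_le f x y" if "x \<in> {1..n}" "y \<in> {1..n}" for x y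
    unfolding fibre_le_ocomp[OF oid_in_OSigma that]
    using that fibre_le_refl[OF f that(1)] fibre_le_refl[OF oid_in_OSigma that(1)]
    by (cases "x = y") (simp_all add: oid_def omap_oinj)
qed (rule f)

lemma oid_ocomp:
  assumes f: "f \<in> OSigma n m" shows "oid m \<circ>\<^sub>O f = f"
proof (rule OSigma_eqI)
  show "oid m \<circ>\<^sub>O f \<in> OSigma n m" by (rule ocomp_in_OSigma[OF f oid_in_OSigma])
  show "omap (oid m \<circ>\<^sub>O f) x = omap f x" if "x \<in> {1..n}" for x
    unfolding omap_ocomp[OF f that] using OSigma_range[OF f that] by (simp add: oid_def omap_oinj)
  show "fibre_le (oid m \<circ>\<^sub>O f) x y = fibre_le f x y" if "x \<in> {1..n}" "y \<in> {1..n}" for x y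
    unfolding oid_def by (rule fibre_le_oinj_ocomp[OF _ f that]) auto
qed (rule f)

text \<open>The increasing enumeration of \<open>I\<close>, numbered from 1, which underlies the morphism \<open>incl\<close>.\<close>

abbreviation enum_elt :: "nat set \<Rightarrow> nat \<Rightarrow> nat" where
  "enum_elt I j \<equiv> sorted_list_of_set I ! (j - 1)"

lemma bij_betw_enum_elt:
  assumes "finite I" shows "bij_betw (enum_elt I) {1..card I} I"
proof -
  have "bij_betw (\<lambda>j. j - 1) {1..card I} {..<card I}"
    by (rule bij_betw_byWitness[where f' = Suc]) auto
  moreover have "bij_betw ((!) (sorted_list_of_set I)) {..<card I} I"
    by (rule bij_betw_nth) (use assms in auto)
  ultimately have "bij_betw ((!) (sorted_list_of_set I) \<circ> (\<lambda>j. j - 1)) {1..card I} I"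
    by (rule bij_betw_trans)
  then show ?thesis by (simp add: comp_def)
qed

context
  fixes k :: nat and I :: "nat set" assumes I: "I \<subseteq> {1..k}"
begin

lemma enum_elt_inj: "inj_on (enum_elt I) {1..card I}"
  and enum_elt_image: "enum_elt I ` {1..card I} = I"
  using bij_betw_enum_elt[OF finite_subset[OF I finite_atLeastAtMost]]
  unfolding bij_betw_def by blast+

lemma enum_elt_Pi: "enum_elt I \<in> {1..card I} \<rightarrow> {1..k}"
  using enum_elt_image I by blast

lemmas enum_elt_in = funcset_mem[OF enum_elt_Pi]

lemma incl_in_OSigma: "incl k I \<in> OSigma (card I) k"
  unfolding incl_def by (rule oinj_in_OSigma[OF enum_elt_inj enum_elt_Pi])

lemma omap_incl: "x \<in> {1..card I} \<Longrightarrow> omap (incl k I) x = enum_elt I x"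
  unfolding incl_def by (rule omap_oinj)

lemma omap_ocomp_incl:
  "x \<in> {1..card I} \<Longrightarrow> omap (h \<circ>\<^sub>O incl k I) x = omap h (enum_elt I x)"
  by (simp only: omap_ocomp[OF incl_in_OSigma] omap_incl)

text \<open>
  Composing with an inclusion is restriction. The diagonal is treated apart, since there the lexicographic
  rule consults the inclusion rather than \<open>h\<close>; both orders are reflexive.
\<close>

lemma fibre_le_ocomp_incl:
  assumes "h \<in> OSigma k m" "x \<in> {1..card I}" "y \<in> {1..card I}"
  shows "fibre_le (h \<circ>\<^sub>O incl k I) x y \<longleftrightarrow> fibre_le h (enum_elt I x) (enum_elt I y)"
proof (cases "x = y")
  case True
  then show ?thesis
    using fibre_le_refl[OF assms(1) enum_elt_in[OF assms(2)]]
      fibre_le_refl[OF ocomp_in_OSigma[OF incl_in_OSigma assms(1)] assms(2)] by simp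
next
  case False
  then show ?thesis
    unfolding fibre_le_ocomp[OF incl_in_OSigma assms(2,3)] omap_incl[OF assms(2)] omap_incl[OF assms(3)]
    using inj_on_eq_iff[OF enum_elt_inj assms(2,3)] by simp
qed

text \<open>
  Since the enumeration is onto \<open>I\<close>, equality of restrictions can be read off on \<open>I\<close> itself. This is what
  makes the morphism described by \<open>bracket\<close> unique.
\<close>

lemma ocomp_incl_eqD:
  assumes h: "h \<in> OSigma k m" "h' \<in> OSigma k m" and eq: "h \<circ>\<^sub>O incl k I = h' \<circ>\<^sub>O incl k I"
    and "x \<in> I" "y \<in> I"
  shows "omap h x = omap h' x" "fibre_le h x y \<longleftrightarrow> fibre_le h' x y"
proof -
  obtain a where a: "a \<in> {1..card I}" "x = enum_elt I a"
    using assms(4) enum_elt_image by blast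
  obtain b where b: "b \<in> {1..card I}" "y = enum_elt I b"
    using assms(5) enum_elt_image by blast
  show "omap h x = omap h' x"
    unfolding a(2) omap_ocomp_incl[OF a(1), symmetric] eq ..
  show "fibre_le h x y \<longleftrightarrow> fibre_le h' x y"
    unfolding a(2) b(2) fibre_le_ocomp_incl[OF h(1) a(1) b(1), symmetric]
      fibre_le_ocomp_incl[OF h(2) a(1) b(1), symmetric] eq ..
qed

end

section \<open>Positions in a concatenation of blocks\<close>

lemma sum_list_take_mono: "a \<le> b \<Longrightarrow> sum_list (take a ks) \<le> sum_list (take b (ks :: nat list))"
  by (auto simp: le_iff_add take_add)

lemma sum_list_take_block:
  "i \<in> {1..length ks} \<Longrightarrow> sum_list (take i ks) = sum_list (take (i - 1) ks) + (ks ! (i - 1) :: nat)"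
  by (cases i) (auto simp: take_Suc_conv_app_nth)

text \<open>
  The labels \<open>(i, j)\<close>, counted from 1, of the points of the concatenation; \<open>bpos ks\<close> is a bijection from
  them onto \<open>{1..sum_list ks}\<close>, with inverse given by \<open>bnum\<close> and \<open>boff\<close>.
\<close>

definition block_index :: "nat list \<Rightarrow> nat \<Rightarrow> nat \<Rightarrow> bool" where
  "block_index ks i j \<longleftrightarrow> i \<in> {1..length ks} \<and> j \<in> {1..ks ! (i - 1)}"

lemma bpos_in: "block_index ks i j \<Longrightarrow> bpos ks i j \<in> {1..sum_list ks}"
  using sum_list_take_block[of i ks] sum_list_take_mono[of i "length ks" ks]
  by (auto simp: block_index_def bpos_def)

lemma bnum_bpos: 
  assumes "block_index ks i j" shows "bnum ks (bpos ks i j) = i"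
  unfolding bnum_def
proof (rule Least_equality)
  show "bpos ks i j \<le> sum_list (take i ks)"
    using assms sum_list_take_block[of i ks] by (auto simp: block_index_def bpos_def)
  show "i \<le> i'" if "bpos ks i j \<le> sum_list (take i' ks)" for i'
  proof (rule ccontr)
    assume "\<not> i \<le> i'"
    then have "sum_list (take i' ks) \<le> sum_list (take (i - 1) ks)"
      by (intro sum_list_take_mono) auto
    then show False using that assms by (auto simp: bpos_def block_index_def)
  qed
qed

lemma boff_bpos: "block_index ks i j \<Longrightarrow> boff ks (bpos ks i j) = j"
  by (simp add: boff_def bnum_bpos) (simp add: bpos_def)

lemma bpos_eq_iff:
  "block_index ks i j \<Longrightarrow> block_index ks i' j' \<Longrightarrow> bpos ks i j = bpos ks i' j' \<longleftrightarrow> i = i' \<and> j = j'"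
  by (metis bnum_bpos boff_bpos)

lemma bpos_cases:
  assumes "p \<in> {1..sum_list ks}"
  obtains i j where "block_index ks i j" "p = bpos ks i j"
proof -
  let ?P = "\<lambda>i. p \<le> sum_list (take i ks)"
  define i where "i = bnum ks p"
  have "?P (length ks)" using assms by simp
  then have i: "?P i" "i \<le> length ks"
    unfolding i_def bnum_def by (rule LeastI, rule Least_le)
  have "i \<noteq> 0" using i(1) assms by (cases i) auto
  moreover from this have less: "\<not> ?P (i - 1)"
    unfolding i_def bnum_def by (intro not_less_Least) simp
  ultimately have "block_index ks i (p - sum_list (take (i - 1) ks))"
    using i sum_list_take_block[of i ks] by (auto simp: block_index_def)
  then show ?thesis using less by (intro that) (auto simp: bpos_def)
qed

text \<open>
  Cutting a concatenation in the middle of the list \<open>xss ! a\<close>; needed because the offset of a block of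
  \<open>concat lss\<close> is the sum of an initial segment of that list.
\<close>

lemma take_concat:
  assumes "a < length xss" "b \<le> length (xss ! a)"
  shows "take (sum_list (map length (take a xss)) + b) (concat xss) =
    concat (take a xss) @ take b (xss ! a)"
proof -
  have "concat xss = concat (take a xss) @ xss ! a @ concat (drop (Suc a) xss)"
    by (metis append_take_drop_id concat.simps(2) concat_append Cons_nth_drop_Suc assms(1))
  then show ?thesis using assms(2) by (simp add: length_concat)
qed

lemma nth_concat_bpos:
  assumes "block_index (map length xss) i j"
  shows "concat xss ! (bpos (map length xss) i j - 1) = xss ! (i - 1) ! (j - 1)"
proof -
  have ij: "i - 1 < length xss" "j \<in> {1..length (xss ! (i - 1))}"
    using assms by (auto simp: block_index_def)
  have "concat xss =
      concat (take (i - 1) xss) @ xss ! (i - 1) @ concat (drop (Suc (i - 1)) xss)"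
    by (metis append_take_drop_id concat.simps(2) concat_append Cons_nth_drop_Suc ij(1))
  moreover have "bpos (map length xss) i j - 1 = length (concat (take (i - 1) xss)) + (j - 1)"
    using ij(2) by (simp add: bpos_def length_concat take_map)
  ultimately show ?thesis using ij(2) by (auto simp: nth_append)
qed

lemma sum_list_concat: "sum_list (concat xss) = sum_list (map sum_list (xss :: nat list list))"
  by (induction xss) auto

text \<open>
  The combinatorial core of associativity: a triple \<open>(i, j, l)\<close> gets the same number whether the first two
  or the last two labels are combined first. Both sides add up all \<open>lss\<close> entries before the block
  \<open>(i, j)\<close>, and then \<open>l\<close>.
\<close>

lemma bpos_concat:
  assumes "block_index (map length lss) i j"
  shows "bpos (concat lss) (bpos (map length lss) i j) l =
    bpos (map sum_list lss) i (bpos (lss ! (i - 1)) j l)"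
proof -
  have ij: "i - 1 < length lss" "j \<in> {1..length (lss ! (i - 1))}"
    using assms by (auto simp: block_index_def)
  have "bpos (map length lss) i j - 1 = sum_list (map length (take (i - 1) lss)) + (j - 1)"
    using ij(2) by (simp add: bpos_def take_map)
  then have "take (bpos (map length lss) i j - 1) (concat lss) =
      concat (take (i - 1) lss) @ take (j - 1) (lss ! (i - 1))"
    using take_concat[OF ij(1), of "j - 1"] ij(2) by auto
  then show ?thesis
    by (simp add: bpos_def sum_list_concat take_map)
qed


lemma perm_list_nth:
  "i \<in> {1..length xs} \<Longrightarrow> perm_list \<pi> xs ! (i - 1) = xs ! (inv \<pi> i - 1)"
  by (auto simp: perm_list_def nth_append simp del: upt_Suc)

lemma length_perm_list: "length (perm_list \<pi> xs) = length xs"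
  by (simp add: perm_list_def del: upt_Suc)

lemma list_all2_nth_pred: "list_all2 P xs ys \<Longrightarrow> i \<in> {1..length ys} \<Longrightarrow> P (xs ! (i - 1)) (ys ! (i - 1))"
  by (rule list_all2_nthD2) auto

lemma list_all2_perm_list:
  assumes \<pi>: "\<pi> permutes {1..length ys}" and P: "list_all2 P xs ys"
  shows "list_all2 P (perm_list \<pi> xs) (perm_list \<pi> ys)"
proof -
  have "P (xs ! (inv \<pi> i - 1)) (ys ! (inv \<pi> i - 1))" if "i \<in> {1..length ys}" for i
    using list_all2_nth_pred[OF P] permutes_in_image[OF permutes_inv[OF \<pi>]] that by blast
  then show ?thesis
    using list_all2_lengthD[OF P]
    by (auto simp: perm_list_def list_all2_map1 list_all2_map2 list_all2_same simp del: upt_Suc)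
qed

lemma sum_list_perm_list:
  assumes \<pi>: "\<pi> permutes {1..length ks}"
  shows "sum_list (perm_list \<pi> ks) = (sum_list ks :: nat)"
proof -
  have "sum_list (perm_list \<pi> ks) = (\<Sum>i\<in>{1..length ks}. ks ! (inv \<pi> i - 1))"
    unfolding perm_list_def sum_list_distinct_conv_sum_set[OF distinct_upt]
    by (simp add: atLeastLessThanSuc_atLeastAtMost del: upt_Suc)
  also have "\<dots> = (\<Sum>i\<in>{1..length ks}. ks ! (i - 1))"
    using sum.permute[OF permutes_inv[OF \<pi>], of "\<lambda>i. ks ! (i - 1)"] by (simp add: comp_def)
  also have "\<dots> = (\<Sum>i<length ks. ks ! i)"
    by (rule sum.reindex_bij_witness[of _ Suc "\<lambda>i. i - 1"]) auto
  finally show ?thesis by (simp add: sum_list_sum_nth atLeast0LessThan)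
qed

lemma block_index_perm_list:
  assumes \<pi>: "\<pi> permutes {1..length ks}"
  shows "block_index (perm_list \<pi> ks) (\<pi> i) j \<longleftrightarrow> block_index ks i j"
proof -
  have "\<pi> i \<in> {1..length ks} \<longleftrightarrow> i \<in> {1..length ks}" by (rule permutes_in_image[OF \<pi>])
  then show ?thesis
    using perm_list_nth[of "\<pi> i" ks \<pi>] permutes_inverses(2)[OF \<pi>]
    by (auto simp: block_index_def length_perm_list)
qed

lemma block_perm_bpos:
  "block_index ks i j \<Longrightarrow> block_perm \<pi> ks (bpos ks i j) = bpos (perm_list \<pi> ks) (\<pi> i) j"
  using bpos_in[of ks i j] by (simp add: block_perm_def bnum_bpos boff_bpos)

lemma block_perm_permutes:
  assumes \<pi>: "\<pi> permutes {1..length ks}"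
  shows "block_perm \<pi> ks permutes {1..sum_list ks}"
proof (rule inj_imp_permutes)
  show "inj_on (block_perm \<pi> ks) {1..sum_list ks}"
  proof (rule inj_onI)
    fix p q assume "p \<in> {1..sum_list ks}" "q \<in> {1..sum_list ks}"
      and eq: "block_perm \<pi> ks p = block_perm \<pi> ks q"
    then obtain i j i' j' where p: "block_index ks i j" "p = bpos ks i j"
      and q: "block_index ks i' j'" "q = bpos ks i' j'" by (metis bpos_cases)
    then have "\<pi> i = \<pi> i' \<and> j = j'"
      using eq by (simp add: block_perm_bpos bpos_eq_iff block_index_perm_list[OF \<pi>])
    then show "p = q" using p q permutes_inj[OF \<pi>] by (auto dest: injD)
  qed
  show "block_perm \<pi> ks p \<in> {1..sum_list ks}" if "p \<in> {1..sum_list ks}" for p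
    using that
  proof (cases rule: bpos_cases)
    case (1 i j)
    then show ?thesis
      using bpos_in[of "perm_list \<pi> ks" "\<pi> i" j]
      by (simp add: block_perm_bpos sum_list_perm_list[OF \<pi>] block_index_perm_list[OF \<pi>])
  qed
qed (auto simp: block_perm_def)

text \<open>
  The action involves inverses. On labels, the block permutation is \<open>(i, j) \<mapsto> (\<pi> i, j)\<close> from the blocks
  \<open>ks\<close> to the permuted blocks, so its inverse changes only the block number.
\<close>

lemma inv_block_perm_bpos:
  assumes \<pi>: "\<pi> permutes {1..length ks}" and ij: "block_index ks (inv \<pi> i) j"
  shows "inv (block_perm \<pi> ks) (bpos (perm_list \<pi> ks) i j) = bpos ks (inv \<pi> i) j"
  using block_perm_bpos[OF ij, of \<pi>] permutes_inverses(1)[OF \<pi>]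
    permutes_inv_eq[OF block_perm_permutes[OF \<pi>]] by simp

lemma block_sum_bpos:
  "block_index ks i j \<Longrightarrow> block_sum ks \<tau>s (bpos ks i j) = bpos ks i ((\<tau>s ! (i - 1)) j)"
  using bpos_in[of ks i j] by (simp add: block_sum_def bnum_bpos boff_bpos)

lemma block_index_permutes:
  "\<tau> permutes {1..ks ! (i - 1)} \<Longrightarrow> block_index ks i (\<tau> j) \<longleftrightarrow> block_index ks i j"
  using permutes_in_image[of \<tau> "{1..ks ! (i - 1)}" j] by (simp add: block_index_def)

context
  fixes \<tau>s :: "(nat \<Rightarrow> nat) list" and ks :: "nat list"
  assumes \<tau>s: "list_all2 (\<lambda>\<tau> m. \<tau> permutes {1..m}) \<tau>s ks"
begin

lemma block_sum_component: "block_index ks i j \<Longrightarrow> (\<tau>s ! (i - 1)) permutes {1..ks ! (i - 1)}"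
  using list_all2_nth_pred[OF \<tau>s] by (simp add: block_index_def)

lemma block_sum_permutes: "block_sum ks \<tau>s permutes {1..sum_list ks}"
proof (rule inj_imp_permutes)
  show "inj_on (block_sum ks \<tau>s) {1..sum_list ks}"
  proof (rule inj_onI)
    fix p q assume "p \<in> {1..sum_list ks}" "q \<in> {1..sum_list ks}"
      and eq: "block_sum ks \<tau>s p = block_sum ks \<tau>s q"
    then obtain i j i' j' where p: "block_index ks i j" "p = bpos ks i j"
      and q: "block_index ks i' j'" "q = bpos ks i' j'" by (metis bpos_cases)
    have "block_index ks i ((\<tau>s ! (i - 1)) j)" and "block_index ks i' ((\<tau>s ! (i' - 1)) j')"
      using p(1) q(1) block_index_permutes[OF block_sum_component] by blast+
    moreover have "bpos ks i ((\<tau>s ! (i - 1)) j) = bpos ks i' ((\<tau>s ! (i' - 1)) j')"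
      using eq unfolding p(2) q(2) block_sum_bpos[OF p(1)] block_sum_bpos[OF q(1)] .
    ultimately have "i = i' \<and> (\<tau>s ! (i - 1)) j = (\<tau>s ! (i' - 1)) j'"
      by (rule bpos_eq_iff[THEN iffD1])
    then show "p = q"
      unfolding p(2) q(2) using permutes_inj[OF block_sum_component[OF p(1)]] by (auto dest: injD)
  qed
  show "block_sum ks \<tau>s p \<in> {1..sum_list ks}" if "p \<in> {1..sum_list ks}" for p
    using that
  proof (cases rule: bpos_cases)
    case (1 i j)
    then show ?thesis
      using bpos_in[of ks i "(\<tau>s ! (i - 1)) j"] block_index_permutes[OF block_sum_component[OF 1(1)]]
      by (simp add: block_sum_bpos)
  qed
qed (auto simp: block_sum_def)

lemma inv_block_sum_bpos:
  assumes ij: "block_index ks i j"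
  shows "inv (block_sum ks \<tau>s) (bpos ks i j) = bpos ks i (inv (\<tau>s ! (i - 1)) j)"
proof -
  note \<tau> = block_sum_component[OF ij]
  have "block_index ks i (inv (\<tau>s ! (i - 1)) j)"
    using block_index_permutes[OF permutes_inv[OF \<tau>]] ij by simp
  from block_sum_bpos[OF this, of \<tau>s] show ?thesis
    using permutes_inverses(1)[OF \<tau>] permutes_inv_eq[OF block_sum_permutes] by simp
qed

end

section \<open>The structure maps\<close>

text \<open>
  The explicit form of \<open>Psi\<close>: \<open>f\<close> chooses the argument by which a point is mapped and compared.
  The relation may use the argument chosen by \<open>x\<close> alone, since points of one fibre choose the same one.
\<close>

definition glue :: "nat list \<Rightarrow> nat \<Rightarrow> omor \<Rightarrow> omor list \<Rightarrow> omor" where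
  "glue ks k f gs = mk_omor k (sum_list ks)
     (\<lambda>x. bpos ks (omap f x) (omap (gs ! (omap f x - 1)) x))
     (\<lambda>x y. fibre_le (gs ! (omap f x - 1)) x y)"

context
  fixes ks :: "nat list" and k :: nat and f :: omor and gs :: "omor list"
  assumes f: "f \<in> OSigma k (length ks)" and gs: "list_all2 (\<lambda>g m. g \<in> OSigma k m) gs ks"
begin

lemma component_in_OSigma: "i \<in> {1..length ks} \<Longrightarrow> gs ! (i - 1) \<in> OSigma k (ks ! (i - 1))"
  using list_all2_nth_pred[OF gs] .

lemmas local_component = component_in_OSigma[OF OSigma_range[OF f]]

lemma block_index_glue:
  "x \<in> {1..k} \<Longrightarrow> block_index ks (omap f x) (omap (gs ! (omap f x - 1)) x)"
  using OSigma_range[OF f] OSigma_range[OF local_component] by (simp add: block_index_def)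

lemma glue_in_OSigma: "glue ks k f gs \<in> OSigma k (sum_list ks)"
  unfolding glue_def
proof (rule mk_omor_in_OSigma)
  let ?\<phi> = "\<lambda>x. bpos ks (omap f x) (omap (gs ! (omap f x - 1)) x)"
  let ?L = "\<lambda>x y. fibre_le (gs ! (omap f x - 1)) x y"
  have sep: "omap f x = omap f y \<and> omap (gs ! (omap f x - 1)) x = omap (gs ! (omap f x - 1)) y"
    if "x \<in> {1..k}" "y \<in> {1..k}" "?\<phi> x = ?\<phi> y" for x y
    using that bpos_eq_iff[OF block_index_glue block_index_glue] by metis
  fix x assume x: "x \<in> {1..k}"
  show "?\<phi> x \<in> {1..sum_list ks}" using bpos_in[OF block_index_glue[OF x]] .
  show "?L x x" using fibre_le_refl[OF local_component[OF x] x] .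
  fix y assume y: "y \<in> {1..k}" and xy: "?\<phi> x = ?\<phi> y"
  show "?L x y \<or> ?L y x"
    using fibre_le_total[OF local_component[OF x] x y conjunct2[OF sep[OF x y xy]]]
    by (simp only: conjunct1[OF sep[OF x y xy]])
  show "x = y" if "?L x y" "?L y x"
    using fibre_le_antisym[OF local_component[OF x] x] sep[OF x y xy] that by simp
  show "?L x z" if "?L x y" "?L y z" for z
    using fibre_le_trans[OF local_component[OF x] x] sep[OF x y xy] that by simp
qed

lemma omap_glue:
  "x \<in> {1..k} \<Longrightarrow> omap (glue ks k f gs) x = bpos ks (omap f x) (omap (gs ! (omap f x - 1)) x)"
  by (simp add: glue_def omap_mk_omor)

lemma fibre_le_glue:
  assumes x: "x \<in> {1..k}" and y: "y \<in> {1..k}"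
  shows "fibre_le (glue ks k f gs) x y \<longleftrightarrow>
    omap f x = omap f y \<and> fibre_le (gs ! (omap f x - 1)) x y"
  using bpos_eq_iff[OF block_index_glue[OF x] block_index_glue[OF y]]
  by (auto simp: glue_def fibre_le_mk_omor[OF x y] dest: fibre_le_same_fibre)

lemma block_incl_inj: "i \<in> {1..length ks} \<Longrightarrow> inj_on (bpos ks i) {1..ks ! (i - 1)}"
  and block_incl_Pi: "i \<in> {1..length ks} \<Longrightarrow> bpos ks i \<in> {1..ks ! (i - 1)} \<rightarrow> {1..sum_list ks}"
  using bpos_in[of ks i] by (auto simp: inj_on_def block_index_def bpos_def)

text \<open>
  On the fibre over \<open>i\<close> the chosen argument is constantly \<open>gs ! (i - 1)\<close>. These are the equations
  that characterise the bracket.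
\<close>

lemma glue_ocomp_incl:
  assumes i: "i \<in> {1..length ks}"
  shows "glue ks k f gs \<circ>\<^sub>O incl k (fib k (omap f) i) =
    block_incl ks i \<circ>\<^sub>O (gs ! (i - 1) \<circ>\<^sub>O incl k (fib k (omap f) i))"
proof -
  let ?I = "fib k (omap f) i"
  have I: "?I \<subseteq> {1..k}" by (auto simp: fib_def)
  note g = component_in_OSigma[OF i]
  note gi = ocomp_in_OSigma[OF incl_in_OSigma[OF I] g]
  have enum: "enum_elt ?I x \<in> {1..k}" "omap f (enum_elt ?I x) = i" if "x \<in> {1..card ?I}" for x
  proof -
    have "enum_elt ?I x \<in> ?I" using that enum_elt_image[OF I] by blast
    then show "enum_elt ?I x \<in> {1..k}" "omap f (enum_elt ?I x) = i"
      by (simp_all only: fib_def mem_Collect_eq)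
  qed
  show ?thesis
  proof (rule OSigma_eqI)
    show "glue ks k f gs \<circ>\<^sub>O incl k ?I \<in> OSigma (card ?I) (sum_list ks)"
      by (rule ocomp_in_OSigma[OF incl_in_OSigma[OF I] glue_in_OSigma])
    show "block_incl ks i \<circ>\<^sub>O (gs ! (i - 1) \<circ>\<^sub>O incl k ?I) \<in> OSigma (card ?I) (sum_list ks)"
      unfolding block_incl_def
      by (rule ocomp_in_OSigma[OF gi oinj_in_OSigma[OF block_incl_inj[OF i] block_incl_Pi[OF i]]])
    fix x assume x: "x \<in> {1..card ?I}"
    show "omap (glue ks k f gs \<circ>\<^sub>O incl k ?I) x =
        omap (block_incl ks i \<circ>\<^sub>O (gs ! (i - 1) \<circ>\<^sub>O incl k ?I)) x"
      unfolding omap_ocomp[OF gi x] block_incl_def omap_oinj[OF OSigma_range[OF gi x]]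
      unfolding omap_ocomp_incl[OF I x] omap_glue[OF enum(1)[OF x]] enum(2)[OF x] ..
    fix y assume y: "y \<in> {1..card ?I}"
    show "fibre_le (glue ks k f gs \<circ>\<^sub>O incl k ?I) x y \<longleftrightarrow>
        fibre_le (block_incl ks i \<circ>\<^sub>O (gs ! (i - 1) \<circ>\<^sub>O incl k ?I)) x y"
      unfolding block_incl_def fibre_le_oinj_ocomp[OF block_incl_Pi[OF i] gi x y]
        fibre_le_ocomp_incl[OF I g x y] fibre_le_ocomp_incl[OF I glue_in_OSigma x y]
        fibre_le_glue[OF enum(1)[OF x] enum(1)[OF y]] enum(2)[OF x] enum(2)[OF y] by simp
  qed
qed

text \<open>
  Uniqueness of the bracket. Inside a fibre of \<open>f\<close> the restrictions decide everything; two points in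
  different fibres are sent to different blocks and are therefore incomparable for both morphisms.
\<close>

lemma eq_glueI:
  assumes h: "h \<in> OSigma k (sum_list ks)"
    and eq: "\<And>i. i \<in> {1..length ks} \<Longrightarrow>
      h \<circ>\<^sub>O incl k (fib k (omap f) i) = glue ks k f gs \<circ>\<^sub>O incl k (fib k (omap f) i)"
  shows "h = glue ks k f gs"
proof -
  have I: "fib k (omap f) i \<subseteq> {1..k}" for i by (auto simp: fib_def)
  note restricted = ocomp_incl_eqD[OF I h glue_in_OSigma eq[OF OSigma_range[OF f]]]
  have map_eq: "omap h x = omap (glue ks k f gs) x" if "x \<in> {1..k}" for x
    using restricted(1)[OF that, of x x] that by (simp add: fib_def)
  show ?thesis
  proof (rule OSigma_eqI[OF h glue_in_OSigma map_eq])
    fix x y assume x: "x \<in> {1..k}" and y: "y \<in> {1..k}"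
    show "fibre_le h x y \<longleftrightarrow> fibre_le (glue ks k f gs) x y"
    proof (cases "omap f x = omap f y")
      case True
      then show ?thesis using restricted(2)[OF x, of x y] x y by (simp add: fib_def)
    next
      case False
      then have "omap h x \<noteq> omap h y"
        using bpos_eq_iff[OF block_index_glue[OF x] block_index_glue[OF y]]
        unfolding map_eq[OF x] map_eq[OF y] omap_glue[OF x] omap_glue[OF y] by simp
      then show ?thesis using False by (auto simp: fibre_le_glue[OF x y] dest: fibre_le_same_fibre)
    qed
  qed
qed

lemma Psi_eq_glue: "Psi ks k (f, gs) = glue ks k f gs"
proof -
  let ?hs = "map (\<lambda>i. gs ! (i - 1) \<circ>\<^sub>O incl k (fib k (omap f) i)) [1..<Suc (length ks)]"
  \<comment> \<open>The block sizes in \<open>bracket\<close> are read off from the targets of its arguments.\<close>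
  have "map ocod ?hs = map (\<lambda>i. ocod (gs ! (i - 1))) [1..<Suc (length ks)]"
    by (simp add: ocomp_def del: upt_Suc)
  also have "\<dots> = map (\<lambda>i. ks ! (i - 1)) [1..<Suc (length ks)]"
    by (rule map_cong[OF refl], rule OSigma_ocod[OF component_in_OSigma]) auto
  also have "\<dots> = ks" by (rule nth_equalityI) (auto simp del: upt_Suc)
  finally have cod: "map ocod ?hs = ks" .
  have hs: "?hs ! (i - 1) = gs ! (i - 1) \<circ>\<^sub>O incl k (fib k (omap f) i)" if "i \<in> {1..length ks}" for i
    using that by (auto simp del: upt_Suc)
  have "Psi ks k (f, gs) = bracket k (omap f) ?hs" by (simp add: Psi_def)
  also have "\<dots> = glue ks k f gs"
    unfolding bracket_def cod
  proof (rule the_equality)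
    show "glue ks k f gs \<in> OSigma k (sum_list ks) \<and> (\<forall>i\<in>{1..length ?hs}.
        glue ks k f gs \<circ>\<^sub>O incl k (fib k (omap f) i) = block_incl ks i \<circ>\<^sub>O ?hs ! (i - 1))"
      using glue_in_OSigma glue_ocomp_incl hs by (simp del: upt_Suc)
  next
    fix h assume "h \<in> OSigma k (sum_list ks) \<and> (\<forall>i\<in>{1..length ?hs}.
        h \<circ>\<^sub>O incl k (fib k (omap f) i) = block_incl ks i \<circ>\<^sub>O ?hs ! (i - 1))"
    then show "h = glue ks k f gs"
      using hs by (intro eq_glueI) (auto simp: glue_ocomp_incl simp del: upt_Suc One_nat_def)
  qed
  finally show ?thesis .
qed

lemmas Psi_in_OSigma = glue_in_OSigma[folded Psi_eq_glue]
  and omap_Psi = omap_glue[folded Psi_eq_glue]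
  and fibre_le_Psi = fibre_le_glue[folded Psi_eq_glue]

end

section \<open>The operad axioms\<close>

lemma elt_orep: "elt (orep n) k = OSigma k n"
  and act_orep: "act (orep n) h f = f \<circ>\<^sub>O h"
  by (simp_all add: orep_def)

lemma elt_oprod_orep: "gs \<in> elt (oprod (map orep ks)) k \<longleftrightarrow> list_all2 (\<lambda>g m. g \<in> OSigma k m) gs ks"
  by (simp add: oprod_def elt_orep list_all2_map2)

lemma act_oprod_orep:
  "length gs = length ks \<Longrightarrow> act (oprod (map orep ks)) h gs = map (\<lambda>g. g \<circ>\<^sub>O h) gs"
  by (induction gs ks rule: list_induct2) (auto simp: oprod_def act_orep)

lemma is_oset_orep: "is_oset (orep n)"
  unfolding is_oset_def elt_orep act_orep
  by (auto intro: ocomp_in_OSigma simp: ocomp_oid ocomp_assoc)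

context
  fixes n k :: nat and \<pi> :: "nat \<Rightarrow> nat" and f :: omor
  assumes \<pi>: "\<pi> permutes {1..n}" and f: "f \<in> OSigma k n"
begin

lemma inv_permutes_inj: "inj_on (inv \<pi>) {1..n}"
  and inv_permutes_Pi: "inv \<pi> \<in> {1..n} \<rightarrow> {1..n}"
  using permutes_inv[OF \<pi>] by (rule permutes_inj_on, blast dest: permutes_in_image)

lemma oinj_inv_in_OSigma: "oinj n n (inv \<pi>) \<in> OSigma n n"
  by (rule oinj_in_OSigma[OF inv_permutes_inj inv_permutes_Pi])

lemma sym_act_in_OSigma: "sym_act n \<pi> k f \<in> OSigma k n"
  unfolding sym_act_def by (rule ocomp_in_OSigma[OF f oinj_inv_in_OSigma])

lemma omap_sym_act: "x \<in> {1..k} \<Longrightarrow> omap (sym_act n \<pi> k f) x = inv \<pi> (omap f x)"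
  by (simp add: sym_act_def omap_ocomp[OF f] omap_oinj OSigma_range[OF f] del: atLeastAtMost_iff One_nat_def)

lemma fibre_le_sym_act:
  "x \<in> {1..k} \<Longrightarrow> y \<in> {1..k} \<Longrightarrow> fibre_le (sym_act n \<pi> k f) x y \<longleftrightarrow> fibre_le f x y"
  unfolding sym_act_def by (rule fibre_le_oinj_ocomp[OF inv_permutes_Pi f])

lemma sym_act_ocomp: "h \<in> OSigma l k \<Longrightarrow> sym_act n \<pi> l (f \<circ>\<^sub>O h) = sym_act n \<pi> k f \<circ>\<^sub>O h"
  unfolding sym_act_def by (rule ocomp_assoc[OF _ f oinj_inv_in_OSigma])

end

lemma sym_act_comp:
  assumes \<pi>: "\<pi> permutes {1..n}" and \<rho>: "\<rho> permutes {1..n}" and f: "f \<in> OSigma k n"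
  shows "sym_act n (\<pi> \<circ> \<rho>) k f = sym_act n \<rho> k (sym_act n \<pi> k f)"
proof -
  note \<pi>\<rho> = permutes_compose[OF \<rho> \<pi>]
  note f' = sym_act_in_OSigma[OF \<pi> f]
  have inv: "inv (\<pi> \<circ> \<rho>) = inv \<rho> \<circ> inv \<pi>"
    by (rule o_inv_distrib) (rule permutes_bij[OF \<pi>], rule permutes_bij[OF \<rho>])
  show ?thesis
    by (rule OSigma_eqI[OF sym_act_in_OSigma[OF \<pi>\<rho> f] sym_act_in_OSigma[OF \<rho> f']])
      (simp_all add: omap_sym_act[OF \<pi>\<rho> f] omap_sym_act[OF \<rho> f'] omap_sym_act[OF \<pi> f]
        fibre_le_sym_act[OF \<pi>\<rho> f] fibre_le_sym_act[OF \<rho> f'] fibre_le_sym_act[OF \<pi> f] inv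
        del: atLeastAtMost_iff One_nat_def)
qed

lemma right_action_sym_act: "right_action orep sym_act"
proof -
  have "sym_act n id k f = f" if "f \<in> OSigma k n" for n k f
    using oid_ocomp[OF that] by (simp add: sym_act_def oid_def)
  then show ?thesis
    unfolding right_action_def is_omap_def elt_orep act_orep
    by (auto simp: sym_act_in_OSigma sym_act_ocomp sym_act_comp)
qed

text \<open>
  Naturality. Points identified by \<open>h\<close> are compared by \<open>h\<close> on both sides; other points are compared, after
  applying \<open>h\<close>, by the argument that \<open>f\<close> chooses.
\<close>

lemma Psi_ocomp:
  assumes f: "f \<in> OSigma k (length ks)" and gs: "list_all2 (\<lambda>g m. g \<in> OSigma k m) gs ks"
    and h: "h \<in> OSigma l k"
  shows "Psi ks l (f \<circ>\<^sub>O h, map (\<lambda>g. g \<circ>\<^sub>O h) gs) = Psi ks k (f, gs) \<circ>\<^sub>O h"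
proof -
  note fh = ocomp_in_OSigma[OF h f]
  have gsh: "list_all2 (\<lambda>g m. g \<in> OSigma l m) (map (\<lambda>g. g \<circ>\<^sub>O h) gs) ks"
    using gs unfolding list_all2_map1 by (rule list_all2_mono) (rule ocomp_in_OSigma[OF h])
  have nth: "map (\<lambda>g. g \<circ>\<^sub>O h) gs ! (omap f (omap h x) - 1) = gs ! (omap f (omap h x) - 1) \<circ>\<^sub>O h"
    if "x \<in> {1..l}" for x
    using OSigma_range[OF f OSigma_range[OF h that]] list_all2_lengthD[OF gs]
    by (intro nth_map) auto
  show ?thesis
  proof (rule OSigma_eqI[OF Psi_in_OSigma[OF fh gsh] ocomp_in_OSigma[OF h Psi_in_OSigma[OF f gs]]])
    fix x assume x: "x \<in> {1..l}"
    note hx = OSigma_range[OF h x]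
    show "omap (Psi ks l (f \<circ>\<^sub>O h, map (\<lambda>g. g \<circ>\<^sub>O h) gs)) x = omap (Psi ks k (f, gs) \<circ>\<^sub>O h) x"
      using x hx by (simp only: omap_Psi[OF fh gsh] omap_ocomp[OF h] omap_Psi[OF f gs] nth)
    fix y assume y: "y \<in> {1..l}"
    note hy = OSigma_range[OF h y]
    show "fibre_le (Psi ks l (f \<circ>\<^sub>O h, map (\<lambda>g. g \<circ>\<^sub>O h) gs)) x y \<longleftrightarrow>
        fibre_le (Psi ks k (f, gs) \<circ>\<^sub>O h) x y"
      using x y hx hy
      by (auto simp: fibre_le_Psi[OF fh gsh] fibre_le_ocomp[OF h] fibre_le_Psi[OF f gs] omap_ocomp[OF h]
          nth simp del: atLeastAtMost_iff One_nat_def)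
  qed
qed

lemma is_omap_Psi: "is_omap (orep (length ks) \<times>\<^sub>O oprod (map orep ks)) (orep (sum_list ks)) (Psi ks)"
  unfolding is_omap_def oprod2_def
  by (auto simp: elt_orep elt_oprod_orep act_orep act_oprod_orep list_all2_lengthD Psi_ocomp
      intro: Psi_in_OSigma)

lemma list_all2_concat:
  "list_all2 (list_all2 P) xss yss \<Longrightarrow> list_all2 P (concat xss) (concat yss)"
  by (induction rule: list_all2_induct) (auto intro: list_all2_appendI)

text \<open>
  With \<open>i = f x\<close> and \<open>j = (gs ! (i - 1)) x\<close>, the left side looks up the entry of \<open>concat hss\<close> with number
  \<open>bpos (map length lss) i j\<close>, which is the entry \<open>hss ! (i - 1) ! (j - 1)\<close> used on the right.
  Points are comparable when they share \<open>i\<close> and \<open>j\<close>, because \<open>bpos\<close> is injective on labels.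
\<close>

lemma Psi_assoc:
  assumes f: "f \<in> OSigma k (length lss)"
    and gs: "list_all2 (\<lambda>g m. g \<in> OSigma k m) gs (map length lss)"
    and hss: "list_all2 (list_all2 (\<lambda>h m. h \<in> OSigma k m)) hss lss"
  shows "Psi (concat lss) k (Psi (map length lss) k (f, gs), concat hss) =
    Psi (map sum_list lss) k (f, map2 (\<lambda>ls (g, hs). Psi ls k (g, hs)) lss (zip gs hss))"
    (is "Psi _ k (?F, _) = Psi _ k (f, ?qs)")
proof -
  have len: "length gs = length lss" "length hss = length lss"
    using gs hss by (auto dest: list_all2_lengthD)
  have lengths: "map length hss = map length lss"
    using hss by (induction rule: list_all2_induct) (auto dest: list_all2_lengthD)
  have f1: "f \<in> OSigma k (length (map length lss))" and f2: "f \<in> OSigma k (length (map sum_list lss))"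
    using f by simp_all
  have F: "?F \<in> OSigma k (length (concat lss))"
    using Psi_in_OSigma[OF f1 gs] by (simp add: length_concat)
  note H = list_all2_concat[OF hss]
  have g: "gs ! (i - 1) \<in> OSigma k (length (lss ! (i - 1)))" if "i \<in> {1..length lss}" for i
    using list_all2_nth_pred[OF gs, of i] that by auto
  have h: "list_all2 (\<lambda>h m. h \<in> OSigma k m) (hss ! (i - 1)) (lss ! (i - 1))"
    if "i \<in> {1..length lss}" for i
    using list_all2_nth_pred[OF hss that] .
  have q: "?qs ! (i - 1) = Psi (lss ! (i - 1)) k (gs ! (i - 1), hss ! (i - 1))"
    if "i \<in> {1..length lss}" for i
    using that len by auto
  have "?qs ! i \<in> OSigma k (map sum_list lss ! i)" if "i < length lss" for i
    using Psi_in_OSigma[OF g h, of "Suc i"] q[of "Suc i"] that by simp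
  then have qs: "list_all2 (\<lambda>g m. g \<in> OSigma k m) ?qs (map sum_list lss)"
    using len by (intro list_all2_all_nthI) auto
  show ?thesis
  proof (rule OSigma_eqI[OF Psi_in_OSigma[OF F H]])
    show "Psi (map sum_list lss) k (f, ?qs) \<in> OSigma k (sum_list (concat lss))"
      using Psi_in_OSigma[OF f2 qs] by (simp add: sum_list_concat)
    fix x assume x: "x \<in> {1..k}"
    define i where "i = omap f x"
    define j where "j = omap (gs ! (i - 1)) x"
    have i: "i \<in> {1..length lss}" unfolding i_def using OSigma_range[OF f x] .
    have ij: "block_index (map length lss) i j"
      unfolding i_def j_def by (rule block_index_glue[OF f1 gs x])
    have Fx: "omap ?F x = bpos (map length lss) i j"
      unfolding i_def j_def by (rule omap_Psi[OF f1 gs x])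
    have hx: "concat hss ! (omap ?F x - 1) = hss ! (i - 1) ! (j - 1)"
      unfolding Fx using nth_concat_bpos[of hss i j] ij by (simp add: lengths)
    show "omap (Psi (concat lss) k (?F, concat hss)) x = omap (Psi (map sum_list lss) k (f, ?qs)) x"
      unfolding omap_Psi[OF F H x] omap_Psi[OF f2 qs x] hx
      unfolding Fx bpos_concat[OF ij] i_def[symmetric] q[OF i] omap_Psi[OF g[OF i] h[OF i] x]
        j_def[symmetric] ..
    fix y assume y: "y \<in> {1..k}"
    show "fibre_le (Psi (concat lss) k (?F, concat hss)) x y \<longleftrightarrow>
        fibre_le (Psi (map sum_list lss) k (f, ?qs)) x y"
      unfolding fibre_le_Psi[OF F H x y] fibre_le_Psi[OF f2 qs x y] hx
      unfolding Fx omap_Psi[OF f1 gs y] i_def[symmetric] q[OF i] fibre_le_Psi[OF g[OF i] h[OF i] x y]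
        j_def[symmetric]
        bpos_eq_iff[OF ij block_index_glue[OF f1 gs y]]
      by (auto simp: j_def)
  qed
qed

lemma operad_assoc_Psi: "operad_assoc orep Psi"
proof -
  have "hss \<in> elt (oprod (map (\<lambda>ls. oprod (map orep ls)) lss)) k \<longleftrightarrow>
      list_all2 (list_all2 (\<lambda>h m. h \<in> OSigma k m)) hss lss" for hss lss k
    by (simp add: oprod_def elt_orep list_all2_map2)
  then show ?thesis
    unfolding operad_assoc_def elt_orep elt_oprod_orep by (simp add: Psi_assoc)
qed

text \<open>
  Acting on \<open>f\<close> replaces \<open>i = f x\<close> by \<open>inv \<pi> i\<close>, and the entry with number \<open>i\<close> of the permuted list is
  the entry with number \<open>inv \<pi> i\<close> of \<open>gs\<close>. So both sides send \<open>x\<close> through the same argument, and the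
  block permutation corrects the order of the blocks.
\<close>

lemma Psi_block_perm:
  assumes \<pi>: "\<pi> permutes {1..length ks}"
    and f: "f \<in> OSigma k (length ks)" and gs: "list_all2 (\<lambda>g m. g \<in> OSigma k m) gs ks"
  shows "Psi ks k (sym_act (length ks) \<pi> k f, gs) =
    sym_act (sum_list ks) (block_perm \<pi> ks) k (Psi (perm_list \<pi> ks) k (f, perm_list \<pi> gs))"
proof -
  let ?f = "sym_act (length ks) \<pi> k f" and ?ks = "perm_list \<pi> ks" and ?gs = "perm_list \<pi> gs"
  note f' = sym_act_in_OSigma[OF \<pi> f]
  have f1: "f \<in> OSigma k (length ?ks)" using f by (simp add: length_perm_list)
  note gs' = list_all2_perm_list[OF \<pi> gs]
  have P: "Psi ?ks k (f, ?gs) \<in> OSigma k (sum_list ks)"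
    using Psi_in_OSigma[OF f1 gs'] by (simp add: sum_list_perm_list[OF \<pi>])
  note B = block_perm_permutes[OF \<pi>]
  have nth: "?gs ! (omap f x - 1) = gs ! (inv \<pi> (omap f x) - 1)" if "x \<in> {1..k}" for x
    using perm_list_nth[of _ gs \<pi>] OSigma_range[OF f that] list_all2_lengthD[OF gs] by simp
  have inv_eq: "inv \<pi> a = inv \<pi> b \<longleftrightarrow> a = b" for a b
    using permutes_inj[OF permutes_inv[OF \<pi>]] by (auto dest: injD)
  show ?thesis
  proof (rule OSigma_eqI[OF Psi_in_OSigma[OF f' gs] sym_act_in_OSigma[OF B P]])
    fix x assume x: "x \<in> {1..k}"
    have ij: "block_index ks (inv \<pi> (omap f x)) (omap (gs ! (inv \<pi> (omap f x) - 1)) x)"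
      using block_index_glue[OF f' gs x] by (simp only: omap_sym_act[OF \<pi> f x])
    show "omap (Psi ks k (?f, gs)) x =
        omap (sym_act (sum_list ks) (block_perm \<pi> ks) k (Psi ?ks k (f, ?gs))) x"
      unfolding omap_Psi[OF f' gs x] omap_sym_act[OF B P x] omap_sym_act[OF \<pi> f x]
        omap_Psi[OF f1 gs' x] nth[OF x] inv_block_perm_bpos[OF \<pi> ij] ..
    fix y assume y: "y \<in> {1..k}"
    show "fibre_le (Psi ks k (?f, gs)) x y \<longleftrightarrow>
        fibre_le (sym_act (sum_list ks) (block_perm \<pi> ks) k (Psi ?ks k (f, ?gs))) x y"
      unfolding fibre_le_Psi[OF f' gs x y] fibre_le_sym_act[OF B P x y]
        fibre_le_Psi[OF f1 gs' x y] omap_sym_act[OF \<pi> f x] omap_sym_act[OF \<pi> f y] nth[OF x] inv_eq ..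
  qed
qed

text \<open>
  Each permutation \<open>\<tau>s ! (i - 1)\<close> relabels only the targets inside its own block, so it can be applied
  before or after gluing, without any effect on the orders.
\<close>

lemma Psi_block_sum:
  assumes \<tau>s: "list_all2 (\<lambda>\<tau> m. \<tau> permutes {1..m}) \<tau>s ks"
    and f: "f \<in> OSigma k (length ks)" and gs: "list_all2 (\<lambda>g m. g \<in> OSigma k m) gs ks"
  shows "Psi ks k (f, map2 (\<lambda>m (\<tau>, g). sym_act m \<tau> k g) ks (zip \<tau>s gs)) =
    sym_act (sum_list ks) (block_sum ks \<tau>s) k (Psi ks k (f, gs))" (is "Psi ks k (f, ?gs) = _")
proof -
  have len: "length \<tau>s = length ks" "length gs = length ks"
    using \<tau>s gs by (auto dest: list_all2_lengthD)
  have nth: "?gs ! (i - 1) = sym_act (ks ! (i - 1)) (\<tau>s ! (i - 1)) k (gs ! (i - 1))"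
    if "i \<in> {1..length ks}" for i
    using that len by auto
  have "?gs ! i \<in> OSigma k (ks ! i)" if "i < length ks" for i
    using sym_act_in_OSigma[OF list_all2_nthD2[OF \<tau>s that] list_all2_nthD2[OF gs that]] that len
    by simp
  then have gs': "list_all2 (\<lambda>g m. g \<in> OSigma k m) ?gs ks"
    using len by (intro list_all2_all_nthI) auto
  note P = Psi_in_OSigma[OF f gs]
  note B = block_sum_permutes[OF \<tau>s]
  show ?thesis
  proof (rule OSigma_eqI[OF Psi_in_OSigma[OF f gs'] sym_act_in_OSigma[OF B P]])
    fix x assume x: "x \<in> {1..k}"
    note i = OSigma_range[OF f x]
    note \<tau> = list_all2_nth_pred[OF \<tau>s i] and g = list_all2_nth_pred[OF gs i]
    show "omap (Psi ks k (f, ?gs)) x =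
        omap (sym_act (sum_list ks) (block_sum ks \<tau>s) k (Psi ks k (f, gs))) x"
      unfolding omap_Psi[OF f gs' x] omap_sym_act[OF B P x] omap_Psi[OF f gs x] nth[OF i]
        omap_sym_act[OF \<tau> g x] inv_block_sum_bpos[OF \<tau>s block_index_glue[OF f gs x]] ..
    fix y assume y: "y \<in> {1..k}"
    show "fibre_le (Psi ks k (f, ?gs)) x y \<longleftrightarrow>
        fibre_le (sym_act (sum_list ks) (block_sum ks \<tau>s) k (Psi ks k (f, gs))) x y"
      unfolding fibre_le_Psi[OF f gs' x y] fibre_le_sym_act[OF B P x y] fibre_le_Psi[OF f gs x y]
        nth[OF i] fibre_le_sym_act[OF \<tau> g x y] ..
  qed
qed

lemma operad_equivariant_Psi: "operad_equivariant orep Psi sym_act"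
  unfolding operad_equivariant_def elt_orep elt_oprod_orep
  by (simp add: Psi_block_perm Psi_block_sum)

theorem theorem3p5:
  shows "nonunital_operad orep Psi sym_act"
  unfolding nonunital_operad_def
  by (simp add: is_oset_orep right_action_sym_act is_omap_Psi operad_assoc_Psi operad_equivariant_Psi)

end
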